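(* Let $q$ be a prime power, let $\mathcal{S}$ be an arbitrary subset of the set $\mathcal{P}$ of primes in $\mathbb{F}_q[T]$, and let $A\in\mathbb{F}_q[T]$ be monic. If $f:\mathbb{N}\to\mathbb{C}$ is an arithmetic function with $f(0)=0$ (here $0\in\mathbb{N}$), then for any positive integer $k$, $$\sum_{\substack{B \text{ monic},\ B\mid A\\ B\in\mathcal{D}(\mathcal{S})}}\mu(B)\binom{\Omega(B)-1}{k-1}f(\delta_1(B))=(-1)^k\,Q_{\mathcal{S}}^{(k)}(A)\,f(\Delta_k(A)).$$
   Context: A prime in $\mathbb{F}_q[T]$ is a monic irreducible polynomial; $\mathcal{P}$ is the set of all primes. For monic $A$, $\mu(A)=1$ if $A=1$, $\mu(A)=(-1)^k$ if $A$ is a product of $k$ distinct primes, and $\mu(A)=0$ otherwise. $\mathcal{N}(A)=\{\deg P: P \text{ prime}, P\mid A\}$ is the set of distinct degrees of prime divisors of $A$, and $\Omega(A)=\#\mathcal{N}(A)$ (this is the number of distinct prime degrees, not the number of prime factors). $\Delta_k(A)$ and $\delta_k(A)$ denote the $k$-th largest and the $k$-th smallest elements of $\mathcal{N}(A)$, respectively, with the convention $\Delta_k(A)=\delta_k(A)=0$ for $k>\Omega(A)$. $P_{\min}(A)=\{P \text{ prime}: P\mid A,\ \deg P=\delta_1(A)\}$. $\mathcal{D}(\mathcal{S})$ is the set of monic $A\in\mathbb{F}_q[T]$ such that $P_{\min}(A)$ has exactly one element $P$ and $P\in\mathcal{S}$ (so $1\notin\mathcal{D}(\mathcal{S})$).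 $Q_{\mathcal{S}}^{(k)}(A)=\#\{P\in\mathcal{S}: P\mid A,\ \deg P=\Delta_k(A)\}$. *)

theory Defs
  imports Complex_Main "HOL-Computational_Algebra.Computational_Algebra"
begin

text \<open>
  The field with q elements is a type of sort \<open>{field, finite}\<close>, so q is its cardinality.
  The definitions need only a field.
\<close>

abbreviation monic :: "'a::field poly \<Rightarrow> bool" where
  "monic A \<equiv> lead_coeff A = 1"

definition monic_primes :: "'a::field poly set" where
  "monic_primes = {P. monic P \<and> irreducible P}"

text \<open>
  The number of factors in the second case is written as the number of prime divisors of \<open>A\<close>;
  lemma \<open>poly_moebius_prod\<close> shows that it is the number of primes in any representation
  of \<open>A\<close> as a product of distinct primes.
\<close>

definition poly_moebius :: "'a::field poly \<Rightarrow> int" where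
  "poly_moebius A =
     (if A = 1 then 1
      else if \<exists>X. finite X \<and> X \<subseteq> monic_primes \<and> A = \<Prod>X
        then (-1) ^ card {P \<in> monic_primes. P dvd A}
      else 0)"

definition prime_degrees :: "'a::field poly \<Rightarrow> nat set" where
  "prime_degrees A = degree ` {P \<in> monic_primes. P dvd A}"

definition num_prime_degrees :: "'a::field poly \<Rightarrow> nat" where
  "num_prime_degrees A = card (prime_degrees A)"

text \<open>
  The list below is strictly increasing and indexed from 0, whereas \<open>k\<close> counts from 1.
  For \<open>k = 0\<close>, which has no meaning in the source, the value is set to 0 as well.
\<close>

definition kth_largest_degree :: "nat \<Rightarrow> 'a::field poly \<Rightarrow> nat" where
  "kth_largest_degree k A =
     (if 1 \<le> k \<and> k \<le> num_prime_degrees A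
      then sorted_list_of_set (prime_degrees A) ! (num_prime_degrees A - k) else 0)"

definition kth_smallest_degree :: "nat \<Rightarrow> 'a::field poly \<Rightarrow> nat" where
  "kth_smallest_degree k A =
     (if 1 \<le> k \<and> k \<le> num_prime_degrees A
      then sorted_list_of_set (prime_degrees A) ! (k - 1) else 0)"

definition min_primes :: "'a::field poly \<Rightarrow> 'a poly set" where
  "min_primes A = {P \<in> monic_primes. P dvd A \<and> degree P = kth_smallest_degree 1 A}"

definition unique_min_prime_in :: "'a::field poly set \<Rightarrow> 'a poly set" where
  "unique_min_prime_in S = {A. monic A \<and> (\<exists>P. min_primes A = {P} \<and> P \<in> S)}"

definition count_largest :: "'a::field poly set \<Rightarrow> nat \<Rightarrow> 'a poly \<Rightarrow> nat" where
  "count_largest S k A = card {P \<in> S. P dvd A \<and> degree P = kth_largest_degree k A}"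

lemma monic_primes_dvd_imp_eq:
  assumes "P \<in> monic_primes" "Q \<in> monic_primes" "P dvd Q"
  shows "P = (Q :: 'a::field poly)"
proof -
  obtain c where c: "Q = P * c" using assms(3) by (elim dvdE)
  have "\<not> P dvd 1" using assms(1) by (auto simp: monic_primes_def irreducible_def)
  moreover have "irreducible Q" using assms(2) by (simp add: monic_primes_def)
  ultimately have "c dvd 1" using c by (auto dest: irreducibleD)
  then obtain a where a: "c = [:a:]" by (auto simp: is_unit_poly_iff)
  have "lead_coeff Q = lead_coeff P * lead_coeff c" using c by (simp add: lead_coeff_mult)
  then have "a = 1" using assms a by (simp add: monic_primes_def)
  then show ?thesis using c a by (simp add: one_pCons)
qed

lemma poly_moebius_prod:
  assumes "finite X" "X \<subseteq> (monic_primes :: 'a::field poly set)"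
  shows "poly_moebius (\<Prod>X) = (-1) ^ card X"
proof -
  have "{P \<in> monic_primes. P dvd \<Prod>X} = X"
  proof (intro equalityI subsetI)
    fix P assume P: "P \<in> {P \<in> monic_primes. P dvd \<Prod>X}"
    then have "prime_elem P"
      by (auto simp: monic_primes_def intro: field_poly_irreducible_imp_prime)
    then obtain Q where "Q \<in> X" "P dvd Q"
      using P by (auto simp: prod_unfold_prod_mset assms(1) elim: prime_elem_dvd_prod_msetE)
    then show "P \<in> X" using P assms(2) monic_primes_dvd_imp_eq by blast
  next
    fix P assume "P \<in> X"
    then show "P \<in> {P \<in> monic_primes. P dvd \<Prod>X}"
      using assms by (auto intro: dvd_prodI)
  qed
  moreover have "{P \<in> monic_primes. P dvd (1 :: 'a poly)} = {}"
    by (auto simp: monic_primes_def irreducible_def)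
  ultimately show ?thesis using assms
    by (cases "\<Prod>X = 1") (auto simp: poly_moebius_def)
qed

end

theory Submission
  imports Defs
begin

text \<open>
  Only squarefree \<open>B\<close> contribute, and these correspond to the sets \<open>Y\<close> of primes dividing \<open>A\<close>.
  Such a \<open>B\<close> lies in \<open>\<D>(S)\<close> iff \<open>Y\<close> is a prime \<open>P \<in> S\<close> together with a set \<open>Z\<close> of primes of
  degree larger than \<open>deg P\<close>. Within each degree, the signed count of nonempty sets of primes
  is \<open>-1\<close>, so for fixed \<open>P\<close> the sum over \<open>Z\<close> becomes a sum over sets \<open>D\<close> of degrees larger than
  \<open>deg P\<close> of \<open>(-1)^|D| (|D| choose k - 1)\<close>. It vanishes unless there are exactly \<open>k - 1\<close> such
  degrees, that is, unless \<open>deg P = \<Delta>\<^sub>k(A)\<close>.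
\<close>

subsection \<open>Alternating sums over subsets\<close>

lemma sum_Pow_insert:
  assumes "finite W" "x \<notin> W"
  shows "(\<Sum>Z\<in>Pow (insert x W). g Z) = (\<Sum>Z\<in>Pow W. g Z + (g (insert x Z) :: 'c::comm_monoid_add))"
proof -
  have "inj_on (insert x) (Pow W)"
    using assms(2) by (auto simp: inj_on_def)
  moreover have "Pow W \<inter> insert x ` Pow W = {}"
    using assms(2) by auto
  ultimately show ?thesis
    using assms(1) by (simp add: Pow_insert sum.union_disjoint sum.reindex sum.distrib)
qed

text \<open>Pairing \<open>Z\<close> with \<open>insert x Z\<close> reverses the sign, so only a
  difference of \<open>g\<close> survives. In particular the sum vanishes when \<open>g\<close> does
  not see whether \<open>x\<close> belongs to its argument.\<close>

lemma alternating_sum_Pow_insert: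
  fixes g :: "'b set \<Rightarrow> 'c::comm_ring_1"
  assumes "finite W" "x \<notin> W"
  shows "(\<Sum>Z\<in>Pow (insert x W). (-1) ^ card Z * g Z)
       = (\<Sum>Z\<in>Pow W. (-1) ^ card Z * (g Z - g (insert x Z)))"
  unfolding sum_Pow_insert[OF assms]
proof (rule sum.cong)
  fix Z assume "Z \<in> Pow W"
  then have "finite Z" "x \<notin> Z"
    using assms finite_subset by auto
  then show "(-1) ^ card Z * g Z + (-1) ^ card (insert x Z) * g (insert x Z)
      = (-1) ^ card Z * (g Z - g (insert x Z))"
    by (simp add: algebra_simps)
qed simp

text \<open>Nonempty subsets of a single fibre of \<open>d\<close> have signed count -1, the sign of
  one element of the image. In the induction, a new \<open>x\<close> either falls into an existing
  fibre and changes nothing, or opens a new fibre and produces the same difference on both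
  sides.\<close>

lemma alternating_sum_Pow_image:
  fixes g :: "'d set \<Rightarrow> 'c::comm_ring_1"
  assumes "finite W"
  shows "(\<Sum>Z\<in>Pow W. (-1) ^ card Z * g (d ` Z)) = (\<Sum>D\<in>Pow (d ` W). (-1) ^ card D * g D)"
  using assms
proof (induction W arbitrary: g)
  case empty
  then show ?case by simp
next
  case (insert x W)
  have split: "(\<Sum>Z\<in>Pow (insert x W). (-1) ^ card Z * g (d ` Z))
      = (\<Sum>Z\<in>Pow W. (-1) ^ card Z * (g (d ` Z) - g (insert (d x) (d ` Z))))"
    using alternating_sum_Pow_insert[OF insert.hyps(1,2), of "\<lambda>Z. g (d ` Z)"] by simp
  show ?case
  proof (cases "d x \<in> d ` W")
    case True
    then obtain y V where V: "W = insert y V" "y \<notin> V" "d y = d x"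
      by (metis imageE mk_disjoint_insert)
    then have "finite V"
      using insert.hyps(1) by simp
    \<comment> \<open>The value \<open>d y = d x\<close> is inserted anyway, so the argument of
      \<open>g\<close> is the same with or without \<open>y\<close>, and pairing along
      \<open>y\<close> cancels everything.\<close>
    then have "(\<Sum>Z\<in>Pow W. (-1) ^ card Z * g (insert (d x) (d ` Z))) = 0"
      using alternating_sum_Pow_insert[of V y "\<lambda>Z. g (insert (d x) (d ` Z))"] V by simp
    then show ?thesis
      unfolding split using insert.IH[of g] True
      by (simp add: algebra_simps sum_subtractf insert_absorb)
  next
    case False
    \<comment> \<open>The induction hypothesis is needed for the difference function, which is why
      \<open>g\<close> is kept arbitrary.\<close>
    then show ?thesis
      unfolding split using insert.IH[of "\<lambda>D. g D - g (insert (d x) D)"] insert.hyps(1)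
      by (simp add: alternating_sum_Pow_insert)
  qed
qed

text \<open>By Pascal's rule the difference for a new element is minus the binomial coefficient with
  \<open>j\<close> lowered by one, so induction on \<open>E\<close> lowers \<open>card E\<close> and
  \<open>j\<close> together. For \<open>j = 0\<close> the difference is zero.\<close>

lemma alternating_sum_Pow_choose:
  assumes "finite E"
  shows "(\<Sum>D\<in>Pow E. (-1) ^ card D * of_nat (card D choose j))
       = (if card E = j then (-1) ^ j else (0 :: 'c::comm_ring_1))"
  using assms
proof (induction E arbitrary: j)
  case empty
  then show ?case by (cases j) auto
next
  case (insert x E)
  have "(\<Sum>D\<in>Pow (insert x E). (-1) ^ card D * of_nat (card D choose j))
      = (\<Sum>D\<in>Pow E. (-1) ^ card D * (of_nat (card D choose j)
          - (of_nat (card (insert x D) choose j) :: 'c)))"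
    by (rule alternating_sum_Pow_insert[OF insert.hyps(1,2)])
  also have "\<dots> = (\<Sum>D\<in>Pow E. (-1) ^ card D * (of_nat (card D choose j)
          - of_nat (Suc (card D) choose j)))"
  proof (rule sum.cong)
    fix D assume "D \<in> Pow E"
    then have "finite D" "x \<notin> D"
      using insert.hyps finite_subset by auto
    then show "(-1) ^ card D * (of_nat (card D choose j) - (of_nat (card (insert x D) choose j) :: 'c))
        = (-1) ^ card D * (of_nat (card D choose j) - of_nat (Suc (card D) choose j))"
      by simp
  qed simp
  also have "\<dots> = (if card (insert x E) = j then (-1) ^ j else 0)"
  proof (cases j)
    case 0
    then show ?thesis using insert.hyps by simp
  next
    case (Suc i)
    then show ?thesis
      using insert.IH[of i] insert.hyps by (simp add: sum_negf)
  qed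
  finally show ?case .
qed

text \<open>To be used with \<open>d\<close> the degree and \<open>W\<close> the prime divisors of
  degree larger than that of a fixed prime.\<close>

lemma alternating_sum_Pow_choose_image:
  assumes "finite W"
  shows "(\<Sum>Z\<in>Pow W. (-1) ^ card Z * of_nat (card (d ` Z) choose j))
       = (if card (d ` W) = j then (-1) ^ j else (0 :: 'c::comm_ring_1))"
  unfolding alternating_sum_Pow_image[OF assms, of "\<lambda>D. of_nat (card D choose j)" d]
  using assms by (intro alternating_sum_Pow_choose finite_imageI)

subsection \<open>Squarefree divisors as sets of primes\<close>

definition prime_divisors :: "'a::field poly \<Rightarrow> 'a poly set" where
  "prime_divisors A = {P \<in> monic_primes. P dvd A}"

lemma prime_degrees_eq: "prime_degrees A = degree ` prime_divisors A"
  by (simp add: prime_degrees_def prime_divisors_def)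

lemma prime_elem_monic_primes: "P \<in> monic_primes \<Longrightarrow> prime_elem (P :: 'a::field poly)"
  by (auto simp: monic_primes_def intro: field_poly_irreducible_imp_prime)

text \<open>A finite field admits only finitely many coefficient lists of bounded length.\<close>

lemma finite_poly_dvd:
  fixes A :: "'a::{field, finite} poly"
  assumes "A \<noteq> 0"
  shows "finite {B. B dvd A}"
proof (rule finite_subset)
  show "{B. B dvd A} \<subseteq> Poly ` {xs. set xs \<subseteq> UNIV \<and> length xs \<le> Suc (degree A)}"
  proof
    fix B assume "B \<in> {B. B dvd A}"
    then have "degree B \<le> degree A"
      using assms by (simp add: dvd_imp_degree_le)
    then have "length (coeffs B) \<le> Suc (degree A)"
      by (cases "B = 0") (auto simp: length_coeffs)
    then show "B \<in> Poly ` {xs. set xs \<subseteq> UNIV \<and> length xs \<le> Suc (degree A)}"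
      by (intro image_eqI[of _ _ "coeffs B"]) auto
  qed
qed (intro finite_imageI finite_lists_length_le finite)

lemma prime_divisors_prod:
  assumes "finite Y" "Y \<subseteq> (monic_primes :: 'a::field poly set)"
  shows "prime_divisors (\<Prod>Y) = Y"
proof (intro equalityI subsetI)
  fix P assume P: "P \<in> prime_divisors (\<Prod>Y)"
  then obtain Q where "Q \<in> Y" "P dvd Q"
    using prime_elem_monic_primes[of P]
    by (auto simp: prime_divisors_def prod_unfold_prod_mset assms(1)
        elim: prime_elem_dvd_prod_msetE)
  then show "P \<in> Y"
    using P assms(2) monic_primes_dvd_imp_eq by (auto simp: prime_divisors_def)
next
  fix P assume "P \<in> Y"
  then show "P \<in> prime_divisors (\<Prod>Y)"
    using assms by (auto simp: prime_divisors_def intro: dvd_prodI)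
qed

lemma prod_prime_divisors_dvd:
  assumes "finite Y" "Y \<subseteq> prime_divisors (A :: 'a::field poly)"
  shows "\<Prod>Y dvd A"
  using assms
proof (induction Y)
  case (insert P Y)
  then obtain C where C: "A = \<Prod>Y * C" by auto
  have P: "P \<in> monic_primes" "P dvd A"
    using insert.prems by (auto simp: prime_divisors_def)
  have "prime_divisors (\<Prod>Y) = Y"
    using insert by (intro prime_divisors_prod) (auto simp: prime_divisors_def)
  then have "\<not> P dvd \<Prod>Y"
    using insert.hyps P by (auto simp: prime_divisors_def)
  \<comment> \<open>Distinct monic primes do not divide each other, so \<open>P\<close> must divide
    the cofactor.\<close>
  then have "P dvd C"
    using P C prime_elem_dvd_mult_iff[OF prime_elem_monic_primes] by blast
  then show ?case
    using insert.hyps C by (simp add: mult.commute mult_dvd_mono)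
qed simp

lemma monic_prod_monic_primes:
  assumes "Y \<subseteq> (monic_primes :: 'a::field poly set)"
  shows "monic (\<Prod>Y)"
  using assms by (auto simp: lead_coeff_prod monic_primes_def intro!: prod.neutral)

lemma poly_moebius_nonzeroD:
  fixes B :: "'a::field poly"
  assumes "poly_moebius B \<noteq> 0"
  shows "finite (prime_divisors B) \<and> B = \<Prod>(prime_divisors B)"
proof -
  \<comment> \<open>The empty product absorbs the separate case \<open>B = 1\<close> in the
    definition of \<open>poly_moebius\<close>.\<close>
  have "finite {} \<and> {} \<subseteq> monic_primes \<and> (1 :: 'a poly) = \<Prod>{}"
    by simp
  then have "\<exists>X. finite X \<and> X \<subseteq> monic_primes \<and> B = \<Prod>X"
    using assms unfolding poly_moebius_def by metis
  then show ?thesis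
    using prime_divisors_prod by metis
qed

section \<open>The smallest prime degree and membership in
  \<open>unique_min_prime_in S\<close>\<close>

lemma kth_smallest_degree_1:
  assumes "finite (prime_divisors B)" "prime_divisors B \<noteq> {}"
  shows "kth_smallest_degree 1 B = Min (degree ` prime_divisors B)"
proof -
  have "sorted_list_of_set (prime_degrees B) ! 0 = Min (prime_degrees B)"
    using assms by (simp add: prime_degrees_eq sorted_list_of_set_nonempty)
  moreover have "num_prime_degrees B \<ge> 1"
    using assms by (simp add: num_prime_degrees_def prime_degrees_eq card_gt_0_iff Suc_le_eq)
  ultimately show ?thesis
    by (simp add: kth_smallest_degree_def prime_degrees_eq)
qed

lemma min_primes_eq:
  "min_primes B = {P \<in> prime_divisors B. degree P = kth_smallest_degree 1 B}"
  by (auto simp: min_primes_def prime_divisors_def)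

lemma kth_smallest_degree_1_prod_insert:
  assumes "finite Z" "insert P Z \<subseteq> (monic_primes :: 'a::field poly set)"
    and "\<forall>Q\<in>Z. degree P < degree Q"
  shows "kth_smallest_degree 1 (\<Prod>(insert P Z)) = degree P"
proof -
  have "prime_divisors (\<Prod>(insert P Z)) = insert P Z"
    using assms by (intro prime_divisors_prod) auto
  moreover have "Min (degree ` insert P Z) = degree P"
    using assms by (intro Min_eqI) (auto simp: less_imp_le)
  ultimately show ?thesis
    using kth_smallest_degree_1[of "\<Prod>(insert P Z)"] assms(1) by simp
qed

lemma prod_in_unique_min_prime_in_iff:
  assumes "finite Y" "Y \<subseteq> (monic_primes :: 'a::field poly set)"
  shows "\<Prod>Y \<in> unique_min_prime_in S \<longleftrightarrow>
    (\<exists>P Z. P \<in> S \<and> Y = insert P Z \<and> (\<forall>Q\<in>Z. degree P < degree Q))"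
proof
  assume "\<Prod>Y \<in> unique_min_prime_in S"
  then obtain P where P: "min_primes (\<Prod>Y) = {P}" "P \<in> S"
    by (auto simp: unique_min_prime_in_def)
  define m where "m = kth_smallest_degree 1 (\<Prod>Y)"
  have eq: "{Q \<in> Y. degree Q = m} = {P}"
    using P(1) by (simp add: min_primes_eq prime_divisors_prod[OF assms] m_def)
  then have "P \<in> Y" "degree P = m" by auto
  then have "m = Min (degree ` Y)"
    using assms kth_smallest_degree_1[of "\<Prod>Y"] by (auto simp: m_def prime_divisors_prod)
  then have "\<forall>Q\<in>Y. m \<le> degree Q"
    using assms(1) by simp
  then have "\<forall>Q\<in>Y - {P}. degree P < degree Q"
    using eq \<open>degree P = m\<close> le_neq_implies_less by fastforce
  then show "\<exists>P Z. P \<in> S \<and> Y = insert P Z \<and> (\<forall>Q\<in>Z. degree P < degree Q)"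
    using P(2) \<open>P \<in> Y\<close> by (metis insert_Diff)
next
  assume "\<exists>P Z. P \<in> S \<and> Y = insert P Z \<and> (\<forall>Q\<in>Z. degree P < degree Q)"
  then obtain P Z where PZ: "P \<in> S" "Y = insert P Z" "\<forall>Q\<in>Z. degree P < degree Q"
    by blast
  have deg: "kth_smallest_degree 1 (\<Prod>Y) = degree P"
    using PZ assms kth_smallest_degree_1_prod_insert[of Z P] by simp
  have "min_primes (\<Prod>Y) = {P}"
    unfolding min_primes_eq prime_divisors_prod[OF assms] deg using PZ by auto
  then show "\<Prod>Y \<in> unique_min_prime_in S"
    using PZ monic_prod_monic_primes[OF assms(2)] by (auto simp: unique_min_prime_in_def)
qed

text \<open>The set of prime divisors of the product recovers \<open>insert P Z\<close>, and
  \<open>P\<close> is its only element of least degree, so the pair is determined by the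
  product.\<close>

lemma bij_betw_prod_unique_min_prime_in:
  fixes S :: "'a::{field, finite} poly set"
  assumes "finite (prime_divisors A)"
  shows "bij_betw (\<lambda>(P, Z). \<Prod>(insert P Z))
    (SIGMA P:S \<inter> prime_divisors A. Pow {Q \<in> prime_divisors A. degree P < degree Q})
    {B. monic B \<and> B dvd A \<and> B \<in> unique_min_prime_in S \<and> poly_moebius B \<noteq> 0}"
    (is "bij_betw ?g ?I ?D")
proof (rule bij_betw_imageI)
  show "inj_on ?g ?I"
  proof (rule inj_onI, safe)
    fix P Z P' Z'
    assume PZ: "P \<in> prime_divisors A" "Z \<subseteq> {Q \<in> prime_divisors A. degree P < degree Q}"
      and PZ': "P' \<in> prime_divisors A" "Z' \<subseteq> {Q \<in> prime_divisors A. degree P' < degree Q}"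
      and eq: "\<Prod>(insert P Z) = \<Prod>(insert P' Z')"
    have "finite Z" "finite Z'"
      using PZ(2) PZ'(2) assms by (auto intro: finite_subset[of _ "prime_divisors A"])
    moreover have "insert P Z \<subseteq> monic_primes" "insert P' Z' \<subseteq> monic_primes"
      using PZ PZ' by (auto simp: prime_divisors_def)
    ultimately have "prime_divisors (\<Prod>(insert P Z)) = insert P Z"
      "prime_divisors (\<Prod>(insert P' Z')) = insert P' Z'"
      by (simp_all only: prime_divisors_prod finite_insert)
    then have ins: "insert P Z = insert P' Z'"
      unfolding eq by (rule trans[OF sym])
    have gt: "\<forall>Q\<in>Z. degree P < degree Q" "\<forall>Q\<in>Z'. degree P' < degree Q"
      using PZ(2) PZ'(2) by auto
    have mem: "P \<in> insert P' Z'" "P' \<in> insert P Z"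
      unfolding ins[symmetric] by (rule insertI1) (unfold ins, rule insertI1)
    have PP: "P = P'"
    proof (rule ccontr)
      assume "P \<noteq> P'"
      then have "P \<in> Z'" "P' \<in> Z"
        using mem by simp_all
      then have "degree P' < degree P" "degree P < degree P'"
        using gt by simp_all
      then show False by simp
    qed
    have "P \<notin> Z" "P' \<notin> Z'"
      using gt by auto
    then have "Z = Z'"
      using ins unfolding PP by (rule insert_ident[THEN iffD1])
    then show "P = P'" "\<And>x. x \<in> Z \<Longrightarrow> x \<in> Z'" "\<And>x. x \<in> Z' \<Longrightarrow> x \<in> Z"
      using PP by auto
  qed
  show "?g ` ?I = ?D"
  proof (intro equalityI subsetI)
    fix B assume "B \<in> ?g ` ?I"
    then obtain P Z where PZ: "P \<in> S" "P \<in> prime_divisors A"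
      "Z \<subseteq> {Q \<in> prime_divisors A. degree P < degree Q}" "B = \<Prod>(insert P Z)"
      by auto
    then have sub: "insert P Z \<subseteq> prime_divisors A" by auto
    then have fin: "finite (insert P Z)" and mp: "insert P Z \<subseteq> monic_primes"
      using assms finite_subset by (auto simp: prime_divisors_def)
    have "\<Prod>(insert P Z) \<in> unique_min_prime_in S"
      unfolding prod_in_unique_min_prime_in_iff[OF fin mp] using PZ by blast
    then show "B \<in> ?D"
      using PZ(4) monic_prod_monic_primes[OF mp] prod_prime_divisors_dvd[OF fin sub]
        poly_moebius_prod[OF fin mp] by simp
  next
    fix B assume B: "B \<in> ?D"
    define Y where "Y = prime_divisors B"
    have fin: "finite Y" and mp: "Y \<subseteq> monic_primes" and BY: "B = \<Prod>Y"
      using B poly_moebius_nonzeroD[of B] by (auto simp: Y_def prime_divisors_def)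
    have "\<Prod>Y \<in> unique_min_prime_in S"
      using B BY by simp
    then obtain P Z where PZ: "P \<in> S" "Y = insert P Z" "\<forall>Q\<in>Z. degree P < degree Q"
      unfolding prod_in_unique_min_prime_in_iff[OF fin mp] by blast
    have "Y \<subseteq> prime_divisors A"
      using B by (auto simp: Y_def prime_divisors_def intro: dvd_trans)
    then show "B \<in> ?g ` ?I"
      using PZ BY by (intro image_eqI[of _ _ "(P, Z)"]) auto
  qed
qed

section \<open>The \<open>k\<close>-th largest degree as a count of larger degrees\<close>

lemma sorted_list_of_set_nth_eq_iff:
  fixes N :: "'b::linorder set"
  assumes "finite N" "d \<in> N" "i < card N"
  shows "sorted_list_of_set N ! i = d \<longleftrightarrow> card {e \<in> N. d < e} = card N - Suc i"
proof -
  define xs where "xs = sorted_list_of_set N"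
  have xs: "set xs = N" "length xs = card N" "sorted_wrt (<) xs" "distinct xs"
    using assms(1) by (simp_all add: xs_def)
  obtain j where j: "j < length xs" "xs ! j = d"
    using assms(2) xs(1) by (metis in_set_conv_nth)
  have "{e \<in> N. d < e} = (!) xs ` {Suc j..<length xs}"
  proof (intro equalityI subsetI)
    fix e assume e: "e \<in> {e \<in> N. d < e}"
    then obtain l where l: "l < length xs" "xs ! l = e"
      using xs(1) by (auto simp: in_set_conv_nth)
    have "j < l"
      using e l j sorted_wrt_nth_less[OF xs(3), of l j]
      by (metis (no_types, lifting) less_asym linorder_neqE_nat mem_Collect_eq order.irrefl)
    then show "e \<in> (!) xs ` {Suc j..<length xs}"
      using l by auto
  next
    fix e assume "e \<in> (!) xs ` {Suc j..<length xs}"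
    then show "e \<in> {e \<in> N. d < e}"
      using sorted_wrt_nth_less[OF xs(3), of j] j xs(1) by auto
  qed
  moreover have "inj_on ((!) xs) {Suc j..<length xs}"
    using xs(4) by (auto simp: inj_on_def nth_eq_iff_index_eq)
  ultimately have "card {e \<in> N. d < e} = card N - Suc j"
    by (simp add: card_image xs(2))
  moreover have "xs ! i = d \<longleftrightarrow> i = j"
    using j assms(3) xs(2,4) by (auto simp: nth_eq_iff_index_eq)
  \<comment> \<open>Both indices are below \<open>card N\<close>, so the truncated subtractions
    agree only if \<open>i = j\<close>.\<close>
  ultimately show ?thesis
    using assms(3) j(1) xs(2) by (auto simp: xs_def)
qed

text \<open>The index \<open>num_prime_degrees A - k\<close> leaves exactly \<open>k - 1\<close>
  entries to its right. This translates the cardinality condition coming from the alternating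
  sum.\<close>

lemma kth_largest_degree_eq_iff:
  assumes "finite (prime_divisors A)" "d \<in> prime_degrees A" "1 \<le> k" "k \<le> num_prime_degrees A"
  shows "kth_largest_degree k A = d \<longleftrightarrow> card {e \<in> prime_degrees A. d < e} = k - 1"
proof -
  have "finite (prime_degrees A)"
    using assms(1) by (simp add: prime_degrees_eq)
  then show ?thesis
    using sorted_list_of_set_nth_eq_iff[of "prime_degrees A" d "num_prime_degrees A - k"] assms(2-4)
    by (auto simp: kth_largest_degree_def num_prime_degrees_def)
qed

section \<open>Evaluation of the divisor sum\<close>

theorem theorem2p1:
  fixes S :: "'a::{field, finite} poly set"
    and A :: "'a poly"
    and f :: "nat \<Rightarrow> complex"
    and k :: nat
  assumes "S \<subseteq> monic_primes"
    and "monic A"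
    and "f 0 = 0"
    and "k \<ge> 1"
  shows "(\<Sum>B | monic B \<and> B dvd A \<and> B \<in> unique_min_prime_in S.
            of_int (poly_moebius B) * of_nat ((num_prime_degrees B - 1) choose (k - 1))
              * f (kth_smallest_degree 1 B))
         = (-1) ^ k * of_nat (count_largest S k A) * f (kth_largest_degree k A)"
proof -
  define X where "X = prime_divisors A"
  define W where "W P = {Q \<in> X. degree P < degree Q}" for P :: "'a poly"
  define T where "T B = of_int (poly_moebius B) * of_nat ((num_prime_degrees B - 1) choose (k - 1))
      * f (kth_smallest_degree 1 B)" for B :: "'a poly"
  have "A \<noteq> 0" using assms(2) by auto
  note fin_dvd = finite_poly_dvd[OF this]
  have finX: "finite X"
    unfolding X_def prime_divisors_def by (rule finite_subset[OF _ fin_dvd]) auto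
  have finW: "finite (W P)" for P
    using finX by (simp add: W_def)
  have SX: "S \<inter> X = {P \<in> S. P dvd A}"
    using assms(1) by (auto simp: X_def prime_divisors_def)
  have degW: "degree ` W P = {e \<in> prime_degrees A. degree P < e}" for P
    by (auto simp: W_def X_def prime_degrees_eq)
  have summand: "T (\<Prod>(insert P Z))
      = - f (degree P) * ((-1) ^ card Z * of_nat (card (degree ` Z) choose (k - 1)))"
    if PZ: "P \<in> S \<inter> X" "Z \<in> Pow (W P)" for P Z
  proof -
    have fin: "finite Z" and mp: "insert P Z \<subseteq> monic_primes"
      and gt: "\<forall>Q\<in>Z. degree P < degree Q"
      using PZ finite_subset[OF _ finW] by (auto simp: W_def X_def prime_divisors_def)
    \<comment> \<open>The prime \<open>P\<close> contributes one extra factor, hence the minus sign,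
      and one extra degree, which cancels the -1 in the binomial coefficient.\<close>
    then have "P \<notin> Z" "degree P \<notin> degree ` Z" by auto
    moreover have "prime_divisors (\<Prod>(insert P Z)) = insert P Z"
      using fin mp by (intro prime_divisors_prod) auto
    ultimately have "num_prime_degrees (\<Prod>(insert P Z)) = Suc (card (degree ` Z))"
      using fin by (simp add: num_prime_degrees_def prime_degrees_eq)
    moreover have "poly_moebius (\<Prod>(insert P Z)) = - ((-1) ^ card Z)"
      using poly_moebius_prod[of "insert P Z"] fin mp \<open>P \<notin> Z\<close> by simp
    ultimately show ?thesis
      unfolding T_def kth_smallest_degree_1_prod_insert[OF fin mp gt] by simp
  qed
  have "(\<Sum>B | monic B \<and> B dvd A \<and> B \<in> unique_min_prime_in S. T B)
      = (\<Sum>B | monic B \<and> B dvd A \<and> B \<in> unique_min_prime_in S \<and> poly_moebius B \<noteq> 0. T B)"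
    \<comment> \<open>Terms with vanishing \<open>poly_moebius B\<close> are dropped so that the
      bijection applies.\<close>
    by (rule sum.mono_neutral_right) (auto simp: T_def intro: finite_subset[OF _ fin_dvd])
  also have "\<dots> = (\<Sum>(P, Z)\<in>(SIGMA P:S \<inter> X. Pow (W P)). T (\<Prod>(insert P Z)))"
    using sum.reindex_bij_betw[OF bij_betw_prod_unique_min_prime_in[OF finX[unfolded X_def]], of T]
    by (simp add: X_def W_def case_prod_unfold)
  also have "\<dots> = (\<Sum>P\<in>S \<inter> X. \<Sum>Z\<in>Pow (W P). T (\<Prod>(insert P Z)))"
    using finX finW by (subst sum.Sigma) auto
  also have "\<dots> = (\<Sum>P\<in>S \<inter> X. - f (degree P) *
      (\<Sum>Z\<in>Pow (W P). (-1) ^ card Z * of_nat (card (degree ` Z) choose (k - 1))))"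
    by (simp only: sum_distrib_left summand cong: sum.cong)
  also have "\<dots> = (\<Sum>P\<in>S \<inter> X. if card {e \<in> prime_degrees A. degree P < e} = k - 1
      then (-1) ^ k * f (degree P) else 0)"
  proof (rule sum.cong)
    fix P
    \<comment> \<open>The sign of \<open>P\<close> joins the \<open>(-1) ^ (k - 1)\<close> of the
      alternating sum; \<open>k\<close> is positive, so \<open>k - 1\<close> is not
      truncated.\<close>
    have "(-1 :: complex) ^ k = - ((-1) ^ (k - 1))"
      using assms(4) by (cases k) auto
    then show "- f (degree P) *
        (\<Sum>Z\<in>Pow (W P). (-1) ^ card Z * of_nat (card (degree ` Z) choose (k - 1)))
      = (if card {e \<in> prime_degrees A. degree P < e} = k - 1 then (-1) ^ k * f (degree P) else 0)"
      unfolding alternating_sum_Pow_choose_image[OF finW] degW by simp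
  qed simp
  also have "\<dots> = (-1) ^ k * of_nat (count_largest S k A) * f (kth_largest_degree k A)"
  proof (cases "k \<le> num_prime_degrees A")
    case True
    have "(\<Sum>P\<in>S \<inter> X. if card {e \<in> prime_degrees A. degree P < e} = k - 1
          then (-1) ^ k * f (degree P) else 0)
        = (\<Sum>P\<in>S \<inter> X. if degree P = kth_largest_degree k A
          then (-1) ^ k * f (kth_largest_degree k A) else 0)"
    proof (rule sum.cong)
      fix P assume "P \<in> S \<inter> X"
      then have "degree P \<in> prime_degrees A"
        by (auto simp: prime_degrees_eq X_def)
      then have "card {e \<in> prime_degrees A. degree P < e} = k - 1
          \<longleftrightarrow> degree P = kth_largest_degree k A"
        using kth_largest_degree_eq_iff[OF finX[unfolded X_def] _ assms(4) True]
        by (metis (no_types))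
      then show "(if card {e \<in> prime_degrees A. degree P < e} = k - 1
          then (-1) ^ k * f (degree P) else 0)
        = (if degree P = kth_largest_degree k A
          then (-1) ^ k * f (kth_largest_degree k A) else 0)"
        by (cases "degree P = kth_largest_degree k A") (simp_all only: if_True if_False)
    qed simp
    also have "\<dots> = (\<Sum>P | P \<in> S \<inter> X \<and> degree P = kth_largest_degree k A.
          (-1) ^ k * f (kth_largest_degree k A))"
      using finX by (subst sum.inter_filter) auto
    also have "\<dots> = (-1) ^ k * of_nat (count_largest S k A) * f (kth_largest_degree k A)"
      by (simp add: SX count_largest_def conj_assoc)
    finally show ?thesis .
  next
    case False
    \<comment> \<open>Here \<open>k\<close> exceeds the number of degrees. At most
      \<open>num_prime_degrees A - 1\<close> degrees lie above \<open>degree P\<close>, so the left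
      side vanishes; on the right, \<open>kth_largest_degree k A\<close> takes its default value 0
      and \<open>f 0 = 0\<close>.\<close>
    have "card {e \<in> prime_degrees A. degree P < e} \<noteq> k - 1" if "P \<in> S \<inter> X" for P
    proof -
      have "degree P \<in> prime_degrees A"
        using that by (auto simp: prime_degrees_eq X_def)
      then have "{e \<in> prime_degrees A. degree P < e} \<subset> prime_degrees A" by blast
      then have "card {e \<in> prime_degrees A. degree P < e} < num_prime_degrees A"
        unfolding num_prime_degrees_def using finX
        by (intro psubset_card_mono) (auto simp: prime_degrees_eq X_def)
      then show ?thesis using False by simp
    qed
    then show ?thesis
      using False assms(3) by (simp add: kth_largest_degree_def)
  qed
  finally show ?thesis
    by (simp add: T_def)
qed

end
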